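(* A defining set in a Latin square of order $n$ has size $\Omega(n^{3/2})$. That is, there exist a constant $c>0$ and an integer $n_0$ such that for every $n\geq n_0$, every Latin square $L$ of order $n$ and every defining set $D$ for $L$, we have $|D|\geq c\,n^{3/2}$.
   Context: For a positive integer $a$, $N(a)=\{0,1,\dots,a-1\}$. A Latin square of order $n$ is an $n\times n$ array, with rows and columns indexed by $N(n)$, in which each cell contains a symbol from $N(n)$ and each symbol occurs precisely once in each row and once in each column. A Latin square $L$ is identified with the set of ordered triples $(i,j,L(i,j))$, where $L(i,j)$ is the symbol in row $i$ and column $j$. A defining set for a Latin square $L$ of order $n$ is a subset $D\subseteq L$ such that if $L''$ is a Latin square of order $n$ and $D\subseteq L''$, then $L''=L$. *)

theory Defs
  imports Complex_Main
begin

text \<open>An array is a function of row and column; only its values on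
  \<open>{..<n} \<times> {..<n}\<close> are relevant.\<close>

definition latin_array :: "nat \<Rightarrow> (nat \<Rightarrow> nat \<Rightarrow> nat) \<Rightarrow> bool" where
  "latin_array n A \<longleftrightarrow>
     (\<forall>i<n. \<forall>j<n. A i j < n) \<and>
     (\<forall>i<n. \<forall>k<n. \<exists>!j. j < n \<and> A i j = k) \<and>
     (\<forall>j<n. \<forall>k<n. \<exists>!i. i < n \<and> A i j = k)"

definition array_triples :: "nat \<Rightarrow> (nat \<Rightarrow> nat \<Rightarrow> nat) \<Rightarrow> (nat \<times> nat \<times> nat) set" where
  "array_triples n A = {(i, j, A i j) | i j. i < n \<and> j < n}"

text \<open>Latin squares are identified with their sets of (row, column, symbol) triples, so that
  equality of Latin squares ignores the values of the array outside the \<open>n \<times> n\<close> grid.\<close>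

definition latin_square :: "nat \<Rightarrow> (nat \<times> nat \<times> nat) set \<Rightarrow> bool" where
  "latin_square n L \<longleftrightarrow> (\<exists>A. latin_array n A \<and> L = array_triples n A)"

definition defining_set ::
    "nat \<Rightarrow> (nat \<times> nat \<times> nat) set \<Rightarrow> (nat \<times> nat \<times> nat) set \<Rightarrow> bool" where
  "defining_set n L D \<longleftrightarrow>
     D \<subseteq> L \<and> (\<forall>L''. latin_square n L'' \<and> D \<subseteq> L'' \<longrightarrow> L'' = L)"

end

theory Submission
  imports Defs
begin

text \<open>
  Let \<open>A\<close> be a Latin square of order \<open>n\<close> that is determined by its entries in a set \<open>P\<close> of cells.
  Two rows \<open>s\<close>, \<open>t\<close> give a permutation of the columns, sending \<open>d\<close> to the column in which row \<open>s\<close>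
  has the symbol \<open>A t d\<close>; in the same way two columns \<open>c\<close>, \<open>c'\<close> give a permutation of the rows. The
  cells of \<open>P\<close> cut the cycles of these permutations into paths whose interior may be altered freely.
  When \<open>P\<close> has far fewer than \<open>n\<^sup>3\<^sup>/\<^sup>2\<close> cells, typical pairs of rows or columns meet only a small
  multiple of \<open>\<surd>n\<close> of them, so that there are few paths and most of them are long compared
  with \<open>\<surd>n\<close>.

  Call \<open>s\<close> and \<open>t\<close> linked for the columns \<open>c\<close>, \<open>c'\<close> if one path of their column permutation
  contains \<open>c\<close> and \<open>c'\<close>. The two rows can then be refilled so that every other column keeps its
  symbols, while \<open>c\<close> gives up \<open>A s c\<close> for \<open>A t c'\<close> and \<open>c'\<close> does the opposite; and there is another
  refilling with \<open>s\<close> and \<open>t\<close> interchanged (\<open>exchange_chain\<close>, \<open>exchange_chain_reverse\<close>). It does not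
  matter in which direction the path runs. A single row \<open>r\<close> achieves the same kind
  of exchange, \<open>A r c\<close> for \<open>A r c'\<close>, by a transposition of two entries, and along a path of the row
  permutation of \<open>c\<close>, \<open>c'\<close> these exchanges telescope. So a linked pair is a shortcut, leading from
  \<open>s\<close> to the successor of \<open>t\<close> or from \<open>t\<close> to the successor of \<open>s\<close>, and every closed walk that is composed
  of shortcuts and pieces of paths yields a second Latin square with the same entries in \<open>P\<close>.

  Consequently no linked pair joins two rows of one path (\<open>rigid_no_chain_over_path\<close>), and two linked
  pairs that join the same two paths cannot cross (\<open>rigid_no_crossing_chains\<close>). A noncrossing family
  between two paths has at most as many members as the paths have rows together, which bounds
  the number of linked pairs for \<open>c\<close>, \<open>c'\<close> by \<open>2 n\<close> times the number of paths (\<open>card_linked_le\<close>):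
  a small multiple of \<open>n\<^sup>3\<^sup>/\<^sup>2\<close>. But every pair of rows without many cells of \<open>P\<close> links about \<open>n\<surd>n\<close>
  pairs of columns already by paths of length about \<open>\<surd>n\<close>, so the average number of linked pairs is
  larger than that if \<open>P\<close> is small (\<open>rigid_card_ge\<close>).
\<close>

section \<open>Latin arrays and prescribed cells\<close>

lemma latin_array_less:
  assumes "latin_array n A" "i < n" "j < n"
  shows "A i j < n"
  using assms unfolding latin_array_def by simp

lemma latin_array_row_image:
  assumes "latin_array n A" "i < n"
  shows "A i ` {..<n} = {..<n}"
proof
  show "A i ` {..<n} \<subseteq> {..<n}" using assms unfolding latin_array_def by auto
  have "\<exists>j<n. A i j = k" if "k < n" for k
    using assms that unfolding latin_array_def by metis
  then show "{..<n} \<subseteq> A i ` {..<n}" by (auto simp: image_iff)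
qed

lemma latin_array_transpose:
  assumes "latin_array n A"
  shows "latin_array n (\<lambda>i j. A j i)"
  using assms unfolding latin_array_def by simp

lemma latin_array_column_image:
  assumes "latin_array n A" "j < n"
  shows "(\<lambda>i. A i j) ` {..<n} = {..<n}"
  using latin_array_row_image[OF latin_array_transpose[OF assms(1)] assms(2)] by simp

lemma latin_arrayI:
  assumes rows: "\<And>i. i < n \<Longrightarrow> A i ` {..<n} = {..<n}"
    and cols: "\<And>j. j < n \<Longrightarrow> (\<lambda>i. A i j) ` {..<n} = {..<n}"
  shows "latin_array n A"
proof -
  have unique: "\<exists>!x. x < n \<and> f x = k" if "f ` {..<n} = {..<n}" "k < n" for f :: "nat \<Rightarrow> nat" and k
  proof -
    have "inj_on f {..<n}" using that(1) by (simp add: eq_card_imp_inj_on)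
    moreover have "k \<in> f ` {..<n}" using that by simp
    then obtain x where "x < n" "f x = k" by auto
    ultimately show ?thesis by (metis inj_onD lessThan_iff)
  qed
  have "A i j < n" if "i < n" "j < n" for i j using rows[OF that(1)] that(2) by blast
  then show ?thesis
    unfolding latin_array_def by (intro conjI allI impI unique rows cols) simp_all
qed

lemma latin_array_row_inj:
  assumes "latin_array n A" "i < n"
  shows "inj_on (A i) {..<n}"
  using latin_array_row_image[OF assms] by (simp add: eq_card_imp_inj_on)

lemma latin_array_column_neq:
  assumes "latin_array n A" "i < n" "i' < n" "j < n" "i \<noteq> i'"
  shows "A i j \<noteq> A i' j"
  using latin_array_row_inj[OF latin_array_transpose[OF assms(1)] assms(4)] assms
  by (auto simp: inj_on_def)

lemma latin_array_row_neq:
  assumes "latin_array n A" "i < n" "j < n" "j' < n" "j \<noteq> j'"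
  shows "A i j \<noteq> A i j'"
  using latin_array_row_inj[OF assms(1,2)] assms by (auto simp: inj_on_def)

definition rigid :: "nat \<Rightarrow> (nat \<Rightarrow> nat \<Rightarrow> nat) \<Rightarrow> (nat \<times> nat) set \<Rightarrow> bool" where
  "rigid n A P \<longleftrightarrow> latin_array n A \<and> P \<subseteq> {..<n} \<times> {..<n} \<and>
     (\<forall>B. latin_array n B \<and> (\<forall>(i, j)\<in>P. B i j = A i j) \<longrightarrow> (\<forall>i<n. \<forall>j<n. B i j = A i j))"

lemma rigid_latin_array: "rigid n A P \<Longrightarrow> latin_array n A"
  unfolding rigid_def by (elim conjE)

lemma rigid_transpose:
  assumes "rigid n A P"
  shows "rigid n (\<lambda>i j. A j i) (P\<inverse>)"
  unfolding rigid_def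
proof (intro conjI allI impI)
  show "latin_array n (\<lambda>i j. A j i)"
    using assms latin_array_transpose unfolding rigid_def by blast
  show "P\<inverse> \<subseteq> {..<n} \<times> {..<n}" using assms unfolding rigid_def by auto
next
  fix B i j assume B: "latin_array n B \<and> (\<forall>(i, j)\<in>P\<inverse>. B i j = A j i)" and ij: "i < n" "j < n"
  have "latin_array n (\<lambda>i j. B j i)" using B latin_array_transpose by simp
  moreover have "\<forall>(i, j)\<in>P. B j i = A i j" using B by auto
  ultimately
  show "B i j = A j i" using assms ij unfolding rigid_def by fast
qed

section \<open>Exchanging symbols between two columns\<close>

text \<open>An exchange refills the rows in \<open>F\<close>. Only the contents of the columns \<open>c\<close> and \<open>c'\<close> may change:
  \<open>c\<close> gives up its symbols in the rows of \<open>S\<close> and \<open>c'\<close> gives up its symbols in the rows of \<open>T\<close>, and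
  each receives what the other one gives up. Only presence of the symbols is
  recorded; since all columns are finite, surjectivity is enough in the end. In this
  form exchanges on disjoint sets of rows can simply be put together.\<close>

definition exchange ::
  "nat \<Rightarrow> (nat \<Rightarrow> nat \<Rightarrow> nat) \<Rightarrow> (nat \<times> nat) set \<Rightarrow> nat \<Rightarrow> nat \<Rightarrow>
   nat set \<Rightarrow> nat set \<Rightarrow> nat set \<Rightarrow> (nat \<Rightarrow> nat \<Rightarrow> nat) \<Rightarrow> bool" where
  "exchange n A P c c' F S T M \<longleftrightarrow>
     F \<subseteq> {..<n} \<and> S \<subseteq> F \<and> T \<subseteq> F \<and>
     (\<forall>r\<in>F. M r ` {..<n} = {..<n}) \<and>
     (\<forall>r\<in>F. \<forall>d. (r, d) \<in> P \<longrightarrow> M r d = A r d) \<and>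
     (\<forall>r\<in>F. \<forall>d<n. d \<noteq> c \<and> d \<noteq> c' \<longrightarrow> (\<exists>r'\<in>F. M r' d = A r d)) \<and>
     (\<forall>r\<in>F - S. \<exists>r'\<in>F. M r' c = A r c) \<and> (\<forall>r\<in>T. \<exists>r'\<in>F. M r' c = A r c') \<and>
     (\<forall>r\<in>F - T. \<exists>r'\<in>F. M r' c' = A r c') \<and> (\<forall>r\<in>S. \<exists>r'\<in>F. M r' c' = A r c)"

lemma exchangeD:
  assumes "exchange n A P c c' F S T M"
  shows "F \<subseteq> {..<n}" "S \<subseteq> F" "T \<subseteq> F"
    and "r \<in> F \<Longrightarrow> M r ` {..<n} = {..<n}"
    and "r \<in> F \<Longrightarrow> (r, d) \<in> P \<Longrightarrow> M r d = A r d"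
    and "r \<in> F \<Longrightarrow> d < n \<Longrightarrow> d \<noteq> c \<Longrightarrow> d \<noteq> c' \<Longrightarrow> \<exists>r'\<in>F. M r' d = A r d"
    and "r \<in> F \<Longrightarrow> r \<notin> S \<Longrightarrow> \<exists>r'\<in>F. M r' c = A r c"
    and "r \<in> T \<Longrightarrow> \<exists>r'\<in>F. M r' c = A r c'"
    and "r \<in> F \<Longrightarrow> r \<notin> T \<Longrightarrow> \<exists>r'\<in>F. M r' c' = A r c'"
    and "r \<in> S \<Longrightarrow> \<exists>r'\<in>F. M r' c' = A r c"
  using assms by (simp_all add: exchange_def)

lemma exchange_Un:
  assumes 1: "exchange n A P c c' F S T M" and 2: "exchange n A P c c' G U V N" and disj: "F \<inter> G = {}"
  shows "exchange n A P c c' (F \<union> G) (S \<union> U) (T \<union> V) (\<lambda>r. if r \<in> F then M r else N r)"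
proof -
  let ?M = "\<lambda>r. if r \<in> F then M r else N r"
  have *: "\<exists>r'\<in>F \<union> G. ?M r' d = x"
    if "(\<exists>r'\<in>F. M r' d = x) \<or> (\<exists>r'\<in>G. N r' d = x)" for d x
    using that
  proof (elim disjE bexE)
    fix r' assume "r' \<in> F" "M r' d = x"
    then show ?thesis by (intro bexI[of _ r']) auto
  next
    fix r' assume "r' \<in> G" "N r' d = x"
    then show ?thesis using disj by (intro bexI[of _ r']) auto
  qed
  have sub: "S \<subseteq> F" "T \<subseteq> F" "U \<subseteq> G" "V \<subseteq> G" "F \<subseteq> {..<n}" "G \<subseteq> {..<n}"
    using exchangeD(1-3)[OF 1] exchangeD(1-3)[OF 2] by simp_all
  show ?thesis
    unfolding exchange_def
  proof (intro conjI ballI allI impI)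
    fix r d assume "r \<in> F \<union> G" "(r, d) \<in> P"
    then show "?M r d = A r d" using exchangeD(5)[OF 1] exchangeD(5)[OF 2] by auto
  next
    fix r assume "r \<in> F \<union> G"
    then show "?M r ` {..<n} = {..<n}" using 1 2 by (cases "r \<in> F") (simp_all add: exchange_def)
  next
    fix r d assume "r \<in> F \<union> G" "d < n" "d \<noteq> c \<and> d \<noteq> c'"
    then show "\<exists>r'\<in>F \<union> G. ?M r' d = A r d"
      by (intro *) (use exchangeD(6)[OF 1] exchangeD(6)[OF 2] in blast)
  next
    fix r assume "r \<in> F \<union> G - (S \<union> U)"
    then show "\<exists>r'\<in>F \<union> G. ?M r' c = A r c"
      by (intro *) (use exchangeD(7)[OF 1] exchangeD(7)[OF 2] in blast)
  next
    fix r assume "r \<in> T \<union> V"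
    then show "\<exists>r'\<in>F \<union> G. ?M r' c = A r c'"
      by (intro *) (use exchangeD(8)[OF 1] exchangeD(8)[OF 2] in blast)
  next
    fix r assume "r \<in> F \<union> G - (T \<union> V)"
    then show "\<exists>r'\<in>F \<union> G. ?M r' c' = A r c'"
      by (intro *) (use exchangeD(9)[OF 1] exchangeD(9)[OF 2] in blast)
  next
    fix r assume "r \<in> S \<union> U"
    then show "\<exists>r'\<in>F \<union> G. ?M r' c' = A r c"
      by (intro *) (use exchangeD(10)[OF 1] exchangeD(10)[OF 2] in blast)
  qed (use sub in blast)+
qed

text \<open>When \<open>c\<close> gives up exactly the symbols that it receives, all columns keep their contents, so
  that the refilled array is a Latin square; by rigidity it is the old one. The later contradictions
  all arise from a balanced exchange that does alter some entry.\<close>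

lemma rigid_balanced_exchange:
  assumes rig: "rigid n A P" and cc: "c < n" "c' < n" "c \<noteq> c'"
    and ex: "exchange n A P c c' F S T M"
    and bal: "(\<lambda>r. A r c) ` S = (\<lambda>r. A r c') ` T"
    and rd: "r \<in> F" "d < n"
  shows "M r d = A r d"
proof -
  define B where "B = (\<lambda>r. if r \<in> F then M r else A r)"
  have A: "latin_array n A" by (rule rigid_latin_array[OF rig])
  have F: "F \<subseteq> {..<n}" "S \<subseteq> F" "T \<subseteq> F" by (fact exchangeD(1-3)[OF ex])+
  have Bin: "\<exists>r<n. B r d = x" if "\<exists>r\<in>F. M r d = x" for d x
    using that F(1) unfolding B_def by auto
  have Bout: "\<exists>r'<n. B r' d = A r d" if "r < n" "r \<notin> F" for r d
    using that unfolding B_def by auto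
  have hit: "\<exists>r'<n. B r' d = k" if "d < n" "k < n" for d k
  proof -
    obtain r where r: "r < n" "A r d = k"
      using latin_array_column_image[OF A \<open>d < n\<close>] \<open>k < n\<close> by (metis imageE lessThan_iff)
    show ?thesis
    proof (cases "r \<in> F")
      case False
      then show ?thesis using Bout r by blast
    next
      case rF: True
      consider "d \<noteq> c" "d \<noteq> c'" | "d = c" "r \<notin> S" | "d = c" "r \<in> S" | "d = c'" "r \<notin> T"
        | "d = c'" "r \<in> T" by blast
      then show ?thesis
      proof cases
        case 1
        then show ?thesis using exchangeD(6)[OF ex rF \<open>d < n\<close>] r(2) by (intro Bin) simp
      next
        case 2
        then show ?thesis using exchangeD(7)[OF ex rF] r(2) by (intro Bin) simp
      next
        case 3
        then obtain t where "t \<in> T" "A t c' = k" using bal r(2) by (metis image_iff)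
        then show ?thesis using exchangeD(8)[OF ex] 3 by (intro Bin) blast
      next
        case 4
        then show ?thesis using exchangeD(9)[OF ex rF] r(2) by (intro Bin) simp
      next
        case 5
        then obtain s where "s \<in> S" "A s c = k" using bal r(2) by (metis image_iff)
        then show ?thesis using exchangeD(10)[OF ex] 5 by (intro Bin) blast
      qed
    qed
  qed
  have rows: "B i ` {..<n} = {..<n}" if "i < n" for i
    using exchangeD(4)[OF ex] latin_array_row_image[OF A that] unfolding B_def by simp
  have "(\<lambda>i. B i d) ` {..<n} = {..<n}" if "d < n" for d
  proof
    show "(\<lambda>i. B i d) ` {..<n} \<subseteq> {..<n}" using rows that by blast
    show "{..<n} \<subseteq> (\<lambda>i. B i d) ` {..<n}" using hit[OF that] by (auto simp: image_iff)
  qed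
  then have "latin_array n B" using rows by (intro latin_arrayI)
  moreover have "\<forall>(i, j)\<in>P. B i j = A i j" using exchangeD(5)[OF ex] unfolding B_def by auto
  ultimately have "B r d = A r d" using rig rd F(1) unfolding rigid_def by blast
  then show ?thesis using rd unfolding B_def by simp
qed

lemma exchange_swap:
  assumes A: "latin_array n A" and cc: "c < n" "c' < n"
    and S: "S \<subseteq> {..<n}" "\<And>r. r \<in> S \<Longrightarrow> (r, c) \<notin> P \<and> (r, c') \<notin> P"
  shows "exchange n A P c c' S S S (\<lambda>r. (A r)(c := A r c', c' := A r c))"
proof -
  have "((A r)(c := A r c', c' := A r c)) ` {..<n} = {..<n}" if "r \<in> S" for r
  proof -
    have "A r ` {..<n} = {..<n}" using latin_array_row_image[OF A] S that by auto
    moreover have "((A r)(c := A r c', c' := A r c)) ` {..<n} = A r ` {..<n}"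
      using cc by (auto simp: image_iff)
    ultimately show ?thesis by simp
  qed
  then show ?thesis
    unfolding exchange_def using S by (auto split: if_splits)
qed

section \<open>Chains\<close>

text \<open>The columns \<open>q 0, \<dots>, q k\<close> are consecutive in the column permutation of the rows \<open>s\<close>, \<open>t\<close>, and
  none of the entries of these rows there is prescribed.\<close>

definition chain ::
  "(nat \<Rightarrow> nat \<Rightarrow> nat) \<Rightarrow> (nat \<times> nat) set \<Rightarrow> nat \<Rightarrow> nat \<Rightarrow> (nat \<Rightarrow> nat) \<Rightarrow> nat \<Rightarrow> bool" where
  "chain A P s t q k \<longleftrightarrow> inj_on q {..k} \<and>
     (\<forall>i<k. A s (q (Suc i)) = A t (q i)) \<and> (\<forall>i\<le>k. (s, q i) \<notin> P \<and> (t, q i) \<notin> P)"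

text \<open>Write \<open>x 0, \<dots>, x (k + 1)\<close> for the symbols along the chain, so that rows \<open>s\<close> and \<open>t\<close> have \<open>x i\<close>
  and \<open>x (i + 1)\<close> in column \<open>q i\<close>. Row \<open>s\<close> is shifted cyclically one place towards \<open>q 0\<close> and row \<open>t\<close>
  one place towards \<open>q k\<close>. A column in the interior just has its two symbols interchanged, while
  the symbols that wrap around, \<open>x 0\<close> and \<open>x (k + 1)\<close>, change places between the end columns.\<close>

lemma exchange_chain:
  assumes A: "latin_array n A" and st: "s < n" "t < n" "s \<noteq> t" and k: "0 < k"
    and q: "chain A P s t q k" "\<And>i. i \<le> k \<Longrightarrow> q i < n"
  obtains M where "exchange n A P (q 0) (q k) {s, t} {s} {t} M" "M s (q 0) \<noteq> A s (q 0)"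
proof -
  define M where "M = (\<lambda>r d. if r = s
      then (if d = q k then A s (q 0) else if d \<in> q ` {..k} then A t d else A s d)
      else (if d = q 0 then A t (q k) else if d \<in> q ` {..k} then A s d else A t d))"
  have q0k: "q 0 \<noteq> q k" using q(1) k unfolding chain_def inj_on_def by force
  have lt: "A r d < n" if "r < n" "d < n" for r d using latin_array_less[OF A that] .
  have step: "A s (q (Suc i)) = A t (q i)" if "i < k" for i using q(1) that unfolding chain_def by blast
  have neq: "q i \<noteq> q j" if "i \<noteq> j" "i \<le> k" "j \<le> k" for i j
    using q(1) that unfolding chain_def inj_on_def by auto
  have free: "(s, d) \<notin> P \<and> (t, d) \<notin> P" if "d \<in> q ` {..k}" for d
    using q(1) that unfolding chain_def by auto
  have Ms: "M s ` {..<n} = {..<n}"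
  proof
    show "M s ` {..<n} \<subseteq> {..<n}" by (auto simp: M_def intro!: lt st q(2))
    show "{..<n} \<subseteq> M s ` {..<n}"
    proof
      fix x assume "x \<in> {..<n}"
      then obtain d where d: "d < n" "A s d = x"
        using latin_array_row_image[OF A st(1)] by (metis imageE lessThan_iff)
      show "x \<in> M s ` {..<n}"
      proof (cases "d \<in> q ` {..k}")
        case False
        then have "M s d = x" using d unfolding M_def by auto
        then show ?thesis using d by auto
      next
        case True
        then obtain i where i: "i \<le> k" "d = q i" by auto
        show ?thesis
        proof (cases i)
          case 0
          then have "M s (q k) = x" using d i unfolding M_def by simp
          then show ?thesis using q(2) by auto
        next
          case (Suc j)
          then have "M s (q j) = x" using d i step[of j] neq[of j k] unfolding M_def by auto
          then show ?thesis using q(2) Suc i by auto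
        qed
      qed
    qed
  qed
  have Mt: "M t ` {..<n} = {..<n}"
  proof
    show "M t ` {..<n} \<subseteq> {..<n}" by (auto simp: M_def intro!: lt st q(2))
    show "{..<n} \<subseteq> M t ` {..<n}"
    proof
      fix x assume "x \<in> {..<n}"
      then obtain d where d: "d < n" "A t d = x"
        using latin_array_row_image[OF A st(2)] by (metis imageE lessThan_iff)
      show "x \<in> M t ` {..<n}"
      proof (cases "d \<in> q ` {..k}")
        case False
        then have "M t d = x" using d st unfolding M_def by auto
        then show ?thesis using d by auto
      next
        case True
        then obtain i where i: "i \<le> k" "d = q i" by auto
        show ?thesis
        proof (cases "i = k")
          case True
          then have "M t (q 0) = x" using d i st unfolding M_def by simp
          then show ?thesis using q(2) by auto
        next
          case False
          then have "M t (q (Suc i)) = x"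
            using d i step[of i] neq[of "Suc i" 0] st unfolding M_def by auto
          then show ?thesis using q(2)[of "Suc i"] False i by auto
        qed
      qed
    qed
  qed
  have inside: "q 0 \<in> q ` {..k}" "q k \<in> q ` {..k}" by auto
  have "exchange n A P (q 0) (q k) {s, t} {s} {t} M"
    unfolding exchange_def using st Ms Mt free q0k inside by (auto simp: M_def)
  moreover have "M s (q 0) \<noteq> A s (q 0)"
    using q0k inside latin_array_column_neq[OF A st(1,2) q(2)[of 0] st(3)] unfolding M_def by auto
  ultimately show ?thesis using that by blast
qed

text \<open>With the symbols \<open>x i\<close> as before, the symbols \<open>x 1\<close> and \<open>x k\<close> can change places between the
  end columns as well. Now the cyclic shifts leave out the entry \<open>x 0\<close> of row \<open>s\<close> in the first column
  and the entry \<open>x (k + 1)\<close> of row \<open>t\<close> in the last one. For \<open>k = 1\<close> nothing would be altered, whence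
  the stronger condition on the length.\<close>

lemma exchange_chain_reverse:
  assumes A: "latin_array n A" and st: "s < n" "t < n" "s \<noteq> t" and k: "1 < k"
    and q: "chain A P s t q k" "\<And>i. i \<le> k \<Longrightarrow> q i < n"
  obtains M where "exchange n A P (q 0) (q k) {s, t} {t} {s} M" "M s (q 1) \<noteq> A s (q 1)"
proof -
  define M where "M = (\<lambda>r d. if r = s
      then (if d = q k then A t (q 0) else if d \<in> q ` {1..k} then A t d else A s d)
      else (if d = q 0 then A s (q k) else if d \<in> q ` {..<k} then A s d else A t d))"
  have q0k: "q 0 \<noteq> q k" using q(1) k unfolding chain_def inj_on_def by force
  have lt: "A r d < n" if "r < n" "d < n" for r d using latin_array_less[OF A that] .
  have step: "A s (q (Suc i)) = A t (q i)" if "i < k" for i using q(1) that unfolding chain_def by blast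
  have neq: "q i \<noteq> q j" if "i \<noteq> j" "i \<le> k" "j \<le> k" for i j
    using q(1) that unfolding chain_def inj_on_def by auto
  have free: "(s, d) \<notin> P \<and> (t, d) \<notin> P" if "d \<in> q ` {..k}" for d
    using q(1) that unfolding chain_def by auto
  have outside: "q 0 \<notin> q ` {1..k}" "q k \<notin> q ` {..<k}"
    using neq[of 0] neq[of k] by (auto simp: image_iff Ball_def)
  have Ms: "M s ` {..<n} = {..<n}"
  proof
    show "M s ` {..<n} \<subseteq> {..<n}" by (auto simp: M_def intro!: lt st q(2))
    show "{..<n} \<subseteq> M s ` {..<n}"
    proof
      fix x assume "x \<in> {..<n}"
      then obtain d where d: "d < n" "A s d = x"
        using latin_array_row_image[OF A st(1)] by (metis imageE lessThan_iff)
      show "x \<in> M s ` {..<n}"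
      proof (cases "d \<in> q ` {1..k}")
        case False
        then have "M s d = x" using d k unfolding M_def by auto
        then show ?thesis using d by auto
      next
        case True
        then obtain i where i: "1 \<le> i" "i \<le> k" "d = q i" by auto
        show ?thesis
        proof (cases "i = 1")
          case True
          then have "M s (q k) = x" using d i step[of 0] k unfolding M_def by simp
          then show ?thesis using q(2) by auto
        next
          case False
          then obtain j where j: "i = Suc j" "1 \<le> j" using i by (cases i) auto
          then have "M s (q j) = x" using d i step[of j] neq[of j k] unfolding M_def by auto
          then show ?thesis using q(2) j i by auto
        qed
      qed
    qed
  qed
  have Mt: "M t ` {..<n} = {..<n}"
  proof
    show "M t ` {..<n} \<subseteq> {..<n}" by (auto simp: M_def intro!: lt st q(2))
    show "{..<n} \<subseteq> M t ` {..<n}"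
    proof
      fix x assume "x \<in> {..<n}"
      then obtain d where d: "d < n" "A t d = x"
        using latin_array_row_image[OF A st(2)] by (metis imageE lessThan_iff)
      show "x \<in> M t ` {..<n}"
      proof (cases "d \<in> q ` {..<k}")
        case False
        then have "d \<noteq> q 0" using k by auto
        then have "M t d = x" using False d st unfolding M_def by auto
        then show ?thesis using d by auto
      next
        case True
        then obtain i where i: "i < k" "d = q i" by auto
        show ?thesis
        proof (cases "Suc i = k")
          case True
          then have "M t (q 0) = x" using d i st step[of i] unfolding M_def by auto
          then show ?thesis using q(2) by auto
        next
          case False
          then have "M t (q (Suc i)) = x"
            using d i step[of i] neq[of "Suc i" 0] st unfolding M_def by auto
          then show ?thesis using q(2)[of "Suc i"] False i by auto
        qed
      qed
    qed
  qed
  have "exchange n A P (q 0) (q k) {s, t} {t} {s} M"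
  proof -
    have mid: "d \<in> q ` {1..k} \<longleftrightarrow> d \<in> q ` {..<k}" if "d \<noteq> q 0" "d \<noteq> q k" for d
    proof
      assume "d \<in> q ` {1..k}"
      then obtain i where "i \<le> k" "d = q i" by auto
      then show "d \<in> q ` {..<k}" using that by (cases "i = k") auto
    next
      assume "d \<in> q ` {..<k}"
      then obtain i where "i < k" "d = q i" by auto
      then show "d \<in> q ` {1..k}" using that by (cases "i = 0") auto
    qed
    have f1: "(s, d) \<notin> P \<and> (t, d) \<notin> P" if "d \<in> q ` {1..k} \<or> d \<in> q ` {..<k}" for d
      using that by (intro free) auto
    have f2: "q 0 \<in> q ` {..<k}" "q k \<in> q ` {1..k}" using k by auto
    show ?thesis
      unfolding exchange_def using st Ms Mt f1 f2 q0k outside mid by (auto simp: M_def)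
  qed
  moreover have "M s (q 1) \<noteq> A s (q 1)"
    using neq[of 1 k] k latin_array_column_neq[OF A st(1,2) q(2)[of 1] st(3)] unfolding M_def by auto
  ultimately show ?thesis using that by blast
qed

section \<open>Forbidden configurations\<close>

text \<open>A closed cycle of the row permutation of two columns can be interchanged between these columns.
  Transposing the square gives the corresponding statement for two rows.\<close>

lemma rigid_no_column_cycle:
  assumes rig: "rigid n A P" and cc: "c < n" "c' < n" "c \<noteq> c'" and k: "0 < k"
    and q: "\<And>i. i < k \<Longrightarrow> q i < n" "\<And>i. i < k \<Longrightarrow> A (q (Suc i)) c = A (q i) c'" "q k = q 0"
    and free: "\<And>i. i < k \<Longrightarrow> (q i, c) \<notin> P \<and> (q i, c') \<notin> P"
  shows False
proof -
  have A: "latin_array n A" by (rule rigid_latin_array[OF rig])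
  let ?S = "q ` {..<k}"
  have S: "?S = q ` Suc ` {..<k}"
  proof -
    have "q ` {..k} = insert (q k) (q ` {..<k})" by (simp add: atMost_Suc lessThan_Suc_atMost[symmetric] lessThan_Suc)
    moreover have "q ` {..k} = insert (q 0) (q ` Suc ` {..<k})"
      by (metis atMost_Suc_eq_insert_0 image_insert lessThan_Suc_atMost k Suc_pred' )
    moreover have "q 0 \<in> q ` {..<k}" using k by blast
    moreover have "q 0 \<in> q ` Suc ` {..<k}"
    proof -
      have "k \<in> Suc ` {..<k}" using k by (auto simp: image_iff intro!: bexI[of _ "k - 1"])
      then show ?thesis using q(3) by (metis image_eqI)
    qed
    ultimately show ?thesis using q(3) by (simp add: insert_absorb)
  qed
  have "(\<lambda>r. A r c) ` ?S = (\<lambda>r. A r c') ` ?S"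
  proof -
    have "(\<lambda>r. A r c) ` ?S = (\<lambda>i. A (q (Suc i)) c) ` {..<k}" unfolding S by (simp add: image_image)
    also have "\<dots> = (\<lambda>r. A r c') ` ?S" using q(2) by (simp add: image_image)
    finally show ?thesis .
  qed
  moreover have "exchange n A P c c' ?S ?S ?S (\<lambda>r. (A r)(c := A r c', c' := A r c))"
    using q(1) free by (intro exchange_swap[OF A cc(1,2)]) auto
  ultimately have "((A (q 0))(c := A (q 0) c', c' := A (q 0) c)) c = A (q 0) c"
    using rigid_balanced_exchange[OF rig cc, of ?S ?S ?S _ "q 0" c] k cc by blast
  then show False using latin_array_row_neq[OF A q(1)[OF k] cc(1,2)] cc(3) by simp
qed

lemma rigid_no_row_cycle:
  assumes rig: "rigid n A P" and st: "s < n" "t < n" "s \<noteq> t" and k: "0 < k"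
    and q: "\<And>i. i < k \<Longrightarrow> q i < n" "\<And>i. i < k \<Longrightarrow> A s (q (Suc i)) = A t (q i)" "q k = q 0"
    and free: "\<And>i. i < k \<Longrightarrow> (s, q i) \<notin> P \<and> (t, q i) \<notin> P"
  shows False
  using rigid_no_column_cycle[OF rigid_transpose[OF rig] st k, of q] q free by simp

text \<open>The rows \<open>q 0, \<dots>, q m\<close> are consecutive in the row permutation of the columns \<open>c\<close>, \<open>c'\<close>.\<close>

definition column_path ::
  "(nat \<Rightarrow> nat \<Rightarrow> nat) \<Rightarrow> (nat \<times> nat) set \<Rightarrow> nat \<Rightarrow> nat \<Rightarrow> (nat \<Rightarrow> nat) \<Rightarrow> nat \<Rightarrow> bool" where
  "column_path A P c c' q m \<longleftrightarrow> chain (\<lambda>i j. A j i) (P\<inverse>) c c' q m"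

text \<open>The symbol of \<open>q i\<close> in \<open>c'\<close> is that of \<open>q (i + 1)\<close> in \<open>c\<close>. Hence transposing the two entries
  in every interior row leaves only one symbol unbalanced at either end of the path.\<close>

lemma column_path_balanced:
  assumes "column_path A P c c' q m"
  shows "(\<lambda>r. A r c) ` q ` {1..m} = (\<lambda>r. A r c') ` q ` {..<m}"
proof -
  have "{1..m} = Suc ` {..<m}" by (simp add: image_Suc_lessThan)
  then have "(\<lambda>r. A r c) ` q ` {1..m} = (\<lambda>i. A (q (Suc i)) c) ` {..<m}" by (simp add: image_image)
  also have "\<dots> = (\<lambda>r. A r c') ` q ` {..<m}"
    using assms unfolding column_path_def chain_def by (simp add: image_image)
  finally show ?thesis .
qed

lemma path_image_ends:
  fixes q :: "nat \<Rightarrow> nat"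
  assumes "0 < m"
  shows "q ` {1..m} = insert (q m) (q ` {1..<m})" "q ` {..<m} = insert (q 0) (q ` {1..<m})"
proof -
  have "{1..m} = insert m {1..<m}" "{..<m} = insert 0 {1..<m}" using assms by auto
  then show "q ` {1..m} = insert (q m) (q ` {1..<m})" "q ` {..<m} = insert (q 0) (q ` {1..<m})"
    by (metis image_insert)+
qed

lemma path_ends_distinct:
  fixes q :: "nat \<Rightarrow> nat"
  assumes "inj_on q {..m}" "0 < m"
  shows "q 0 \<notin> q ` {1..<m}" "q m \<notin> q ` {1..<m}" "q 0 \<noteq> q m"
proof -
  have neq: "q i \<noteq> q j" if "i < j" "j \<le> m" for i j
    using inj_onD[OF assms(1), of i j] that by auto
  show "q 0 \<notin> q ` {1..<m}"
  proof
    assume "q 0 \<in> q ` {1..<m}"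
    then obtain i where "1 \<le> i" "i < m" "q 0 = q i" by auto
    then show False using neq[of 0 i] by simp
  qed
  show "q m \<notin> q ` {1..<m}"
  proof
    assume "q m \<in> q ` {1..<m}"
    then obtain i where "1 \<le> i" "i < m" "q m = q i" by auto
    then show False using neq[of i m] by simp
  qed
  show "q 0 \<noteq> q m" using neq assms(2) by simp
qed

text \<open>The exchange on rows \<open>a\<close>, \<open>b\<close> supplies the symbol of \<open>b\<close> in \<open>c'\<close> and consumes the symbol of \<open>a\<close>
  in \<open>c\<close>: exactly what the transpositions along a path from \<open>b\<close> to \<open>a\<close> leave unbalanced.\<close>

lemma rigid_no_chain_over_path:
  assumes rig: "rigid n A P" and cc: "c < n" "c' < n" "c \<noteq> c'"
    and ex: "exchange n A P c c' {a, b} {a} {b} M"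
    and change: "r \<in> {a, b}" "d < n" "M r d \<noteq> A r d"
    and q: "column_path A P c c' q m" "0 < m" "q 0 = b" "q m = a" "\<And>i. i \<le> m \<Longrightarrow> q i < n"
  shows False
proof -
  have A: "latin_array n A" by (rule rigid_latin_array[OF rig])
  define I where "I = q ` {1..<m}"
  have inj: "inj_on q {..m}" and free: "\<And>i. i \<le> m \<Longrightarrow> (q i, c) \<notin> P \<and> (q i, c') \<notin> P"
    using q(1) unfolding column_path_def chain_def by auto
  have "exchange n A P c c' I I I (\<lambda>r. (A r)(c := A r c', c' := A r c))"
    unfolding I_def using q(5) free by (intro exchange_swap[OF A cc(1,2)]) auto
  moreover have "{a, b} \<inter> I = {}"
    using path_ends_distinct[OF inj q(2)] q(3,4) unfolding I_def by simp
  ultimately have ex2: "exchange n A P c c' ({a, b} \<union> I) ({a} \<union> I) ({b} \<union> I)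
      (\<lambda>r. if r \<in> {a, b} then M r else (A r)(c := A r c', c' := A r c))"
    by (intro exchange_Un ex)
  have "{a} \<union> I = q ` {1..m}" "{b} \<union> I = q ` {..<m}"
    using path_image_ends[OF q(2), of q] q(3,4) unfolding I_def by simp_all
  then have "(\<lambda>r. A r c) ` ({a} \<union> I) = (\<lambda>r. A r c') ` ({b} \<union> I)"
    using column_path_balanced[OF q(1)] by simp
  from rigid_balanced_exchange[OF rig cc ex2 this, of r d] show False using change by auto
qed

text \<open>The closed walk here is \<open>a\<close>, shortcut to the successor of \<open>b\<close>, path to \<open>a'\<close>, shortcut to the
  successor of \<open>b'\<close>, path back to \<open>a\<close>. Disjointness of the two paths ensures that every row takes part
  in only one of the exchanges.\<close>

lemma rigid_no_crossing_chains:
  assumes rig: "rigid n A P" and cc: "c < n" "c' < n" "c \<noteq> c'"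
    and ex: "exchange n A P c c' {a, b} {a} {b} M" "exchange n A P c c' {a', b'} {a'} {b'} M'"
    and change: "r \<in> {a, b}" "d < n" "M r d \<noteq> A r d"
    and q: "column_path A P c c' q m" "0 < m" "q 0 = b" "q m = a'" "\<And>i. i \<le> m \<Longrightarrow> q i < n"
    and q': "column_path A P c c' q' m'" "0 < m'" "q' 0 = b'" "q' m' = a" "\<And>i. i \<le> m' \<Longrightarrow> q' i < n"
    and disj: "q ` {..m} \<inter> q' ` {..m'} = {}"
  shows False
proof -
  have A: "latin_array n A" by (rule rigid_latin_array[OF rig])
  define I where "I = q ` {1..<m} \<union> q' ` {1..<m'}"
  have inj: "inj_on q {..m}" "inj_on q' {..m'}"
    and free: "\<And>i. i \<le> m \<Longrightarrow> (q i, c) \<notin> P \<and> (q i, c') \<notin> P"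
      "\<And>i. i \<le> m' \<Longrightarrow> (q' i, c) \<notin> P \<and> (q' i, c') \<notin> P"
    using q(1) q'(1) unfolding column_path_def chain_def by auto
  have sw: "exchange n A P c c' I I I (\<lambda>r. (A r)(c := A r c', c' := A r c))"
    unfolding I_def using q(5) q'(5) free by (intro exchange_swap[OF A cc(1,2)]) auto
  have ends: "a \<in> q' ` {..m'}" "b' \<in> q' ` {..m'}" "a' \<in> q ` {..m}" "b \<in> q ` {..m}"
    using q(3,4) q'(3,4) by force+
  note distinct = path_ends_distinct[OF inj(1) q(2), unfolded q(3,4)]
    path_ends_distinct[OF inj(2) q'(2), unfolded q'(3,4)]
  have "b \<noteq> a'" "b' \<noteq> a" using distinct by simp_all
  then have d1: "{a, b} \<inter> {a', b'} = {}" using ends disj by auto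
  have "b \<notin> q ` {1..<m}" "a' \<notin> q ` {1..<m}" "b' \<notin> q' ` {1..<m'}" "a \<notin> q' ` {1..<m'}"
    using distinct by simp_all
  moreover have "b \<notin> q' ` {1..<m'}" "a' \<notin> q' ` {1..<m'}" "b' \<notin> q ` {1..<m}" "a \<notin> q ` {1..<m}"
    using ends disj by force+
  ultimately have d2: "({a, b} \<union> {a', b'}) \<inter> I = {}" unfolding I_def by blast
  note ex2 = exchange_Un[OF exchange_Un[OF ex d1] sw d2]
  have S: "{a} \<union> {a'} \<union> I = q ` {1..m} \<union> q' ` {1..m'}" and T: "{b} \<union> {b'} \<union> I = q ` {..<m} \<union> q' ` {..<m'}"
    using path_image_ends[OF q(2), of q] path_image_ends[OF q'(2), of q'] q(3,4) q'(3,4)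
    unfolding I_def by auto
  have "(\<lambda>r. A r c) ` ({a} \<union> {a'} \<union> I) = (\<lambda>r. A r c') ` ({b} \<union> {b'} \<union> I)"
    unfolding S T image_Un using column_path_balanced[OF q(1)] column_path_balanced[OF q'(1)] by simp
  from rigid_balanced_exchange[OF rig cc ex2 this, of r d] show False using change by auto
qed

section \<open>Permutations given by two lines\<close>

text \<open>The permutation of the columns given by the rows \<open>s\<close>, \<open>t\<close>. Applied to the transposed array it is
  the permutation of the rows given by two columns.\<close>

definition link :: "nat \<Rightarrow> (nat \<Rightarrow> nat \<Rightarrow> nat) \<Rightarrow> nat \<Rightarrow> nat \<Rightarrow> nat \<Rightarrow> nat" where
  "link n A s t d = inv_into {..<n} (A s) (A t d)"

lemma link:
  assumes A: "latin_array n A" and st: "s < n" "t < n" and d: "d < n"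
  shows "link n A s t d < n" "A s (link n A s t d) = A t d"
proof -
  have "A t d \<in> A s ` {..<n}"
    using latin_array_row_image[OF A st(1)] latin_array_less[OF A st(2) d] by simp
  then show "link n A s t d < n" "A s (link n A s t d) = A t d"
    unfolding link_def using inv_into_into[of "A t d" "A s" "{..<n}"] f_inv_into_f[of "A t d" "A s" "{..<n}"]
    by (simp_all add: lessThan_iff[symmetric] del: lessThan_iff)
qed

lemma link_funpow_less:
  assumes A: "latin_array n A" and st: "s < n" "t < n" and d: "d < n"
  shows "(link n A s t ^^ i) d < n"
  by (induction i) (use link[OF A st] d in auto)

lemma inj_on_link_funpow:
  assumes A: "latin_array n A" and st: "s < n" "t < n"
  shows "inj_on (link n A s t ^^ i) {..<n}"
proof (induction i)
  case (Suc i)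
  have "inj_on (link n A s t) {..<n}"
    using link(2)[OF A st] latin_array_row_neq[OF A st(2)] by (intro inj_onI) (metis lessThan_iff)
  then show ?case
    using Suc link_funpow_less[OF A st] by (auto simp: inj_on_def)
qed simp

text \<open>The iterates are distinct because an early return would close a cycle that avoids \<open>P\<close>.\<close>

lemma chain_link:
  assumes rig: "rigid n A P" and st: "s < n" "t < n" "s \<noteq> t" and d: "d < n"
    and free: "\<And>i. i \<le> k \<Longrightarrow> (s, (link n A s t ^^ i) d) \<notin> P \<and> (t, (link n A s t ^^ i) d) \<notin> P"
  shows "chain A P s t (\<lambda>i. (link n A s t ^^ i) d) k"
proof -
  have A: "latin_array n A" by (rule rigid_latin_array[OF rig])
  let ?q = "\<lambda>i. (link n A s t ^^ i) d"
  have step: "A s (?q (Suc i)) = A t (?q i)" for i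
    using link(2)[OF A st(1,2) link_funpow_less[OF A st(1,2) d]] by simp
  have "?q i \<noteq> ?q j" if "i < j" "j \<le> k" for i j
  proof
    assume eq: "?q i = ?q j"
    show False
      by (rule rigid_no_row_cycle[OF rig st, of "j - i" "\<lambda>l. ?q (i + l)"])
        (use that eq step link_funpow_less[OF A st(1,2) d] free in \<open>auto simp del: funpow.simps\<close>)
  qed
  then have "inj_on ?q {..k}" unfolding inj_on_def by (metis atMost_iff linorder_neqE_nat)
  then show ?thesis unfolding chain_def using step free by auto
qed

text \<open>Every path ends in a row meeting \<open>P\<close> in one of the two columns. The row \<open>e r\<close> in which the path
  of \<open>r\<close> ends serves as the name of this path, and the distance \<open>h r\<close> to the end gives the position of
  \<open>r\<close> on it: larger \<open>h\<close> means earlier.\<close>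

lemma column_paths_exist:
  assumes rig: "rigid n A P" and cc: "c < n" "c' < n" "c \<noteq> c'"
  obtains e h :: "nat \<Rightarrow> nat" where
    "\<And>r. r < n \<Longrightarrow> e r < n \<and> ((e r, c) \<in> P \<or> (e r, c') \<in> P)"
    "\<And>r r'. r < n \<Longrightarrow> r' < n \<Longrightarrow> e r = e r' \<Longrightarrow> h r = h r' \<Longrightarrow> r = r'"
    "\<And>r r'. r < n \<Longrightarrow> r' < n \<Longrightarrow> e r = e r' \<Longrightarrow> h r' < h r \<Longrightarrow> (r', c) \<notin> P \<Longrightarrow> (r', c') \<notin> P \<Longrightarrow>
       \<exists>q m. column_path A P c c' q m \<and> 0 < m \<and> q 0 = r \<and> q m = r' \<and> (\<forall>i\<le>m. q i < n \<and> e (q i) = e r)"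
proof -
  let ?B = "\<lambda>i j. A j i"
  let ?p = "link n ?B c c'"
  define Y where "Y = {r. (r, c) \<in> P \<or> (r, c') \<in> P}"
  have rigB: "rigid n ?B (P\<inverse>)" by (rule rigid_transpose[OF rig])
  then have B: "latin_array n ?B" by (rule rigid_latin_array)
  note less = link_funpow_less[OF B cc(1,2)]
  note inj = inj_on_link_funpow[OF B cc(1,2)]
  have path: "column_path A P c c' (\<lambda>i. (?p ^^ i) r) k"
    if "r < n" "\<And>i. i \<le> k \<Longrightarrow> (?p ^^ i) r \<notin> Y" for r k
    unfolding column_path_def using that chain_link[OF rigB cc that(1), of k] unfolding Y_def by simp
  have hit: "\<exists>i. (?p ^^ i) r \<in> Y" if "r < n" for r
  proof (rule ccontr)
    assume "\<nexists>i. (?p ^^ i) r \<in> Y"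
    then have "inj_on (\<lambda>i. (?p ^^ i) r) {..n}"
      using path[OF that, of n] unfolding column_path_def chain_def by blast
    moreover have "(\<lambda>i. (?p ^^ i) r) ` {..n} \<subseteq> {..<n}" using less[OF that] by auto
    ultimately have "card {..n} \<le> card {..<n}" by (metis card_inj_on_le finite_lessThan)
    then show False by simp
  qed
  define h where "h r = (LEAST i. (?p ^^ i) r \<in> Y)" for r
  define e where "e r = (?p ^^ h r) r" for r
  have eY: "e r \<in> Y" if "r < n" for r
    unfolding e_def h_def using hit[OF that] by (rule LeastI_ex)
  have before: "(?p ^^ i) r \<notin> Y" if "i < h r" for r i
    using that not_less_Least unfolding h_def by blast
  have h_shift: "h ((?p ^^ i) r) = h r - i" if "r < n" "i \<le> h r" for r i
  proof -
    have eq: "(?p ^^ j) ((?p ^^ i) r) = (?p ^^ (j + i)) r" for j by (simp add: funpow_add)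
    have "(LEAST j. (?p ^^ j) ((?p ^^ i) r) \<in> Y) = h r - i"
    proof (rule Least_equality)
      show "(?p ^^ (h r - i)) ((?p ^^ i) r) \<in> Y"
        using eY[OF that(1)] that(2) unfolding eq e_def by simp
      show "h r - i \<le> j" if "(?p ^^ j) ((?p ^^ i) r) \<in> Y" for j
        using before[of "j + i" r] that unfolding eq by linarith
    qed
    then show ?thesis unfolding h_def[of "(?p ^^ i) r"] .
  qed
  have e_shift: "e ((?p ^^ i) r) = e r" if "r < n" "i \<le> h r" for r i
  proof -
    have "e ((?p ^^ i) r) = (?p ^^ (h r - i + i)) r"
      unfolding e_def[of "(?p ^^ i) r"] h_shift[OF that] by (simp add: funpow_add)
    then show ?thesis using that(2) unfolding e_def by simp
  qed
  have same: "r = r'" if "r < n" "r' < n" "e r = e r'" "h r = h r'" for r r'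
    using inj[of "h r"] that unfolding e_def by (auto dest: inj_onD)
  show thesis
  proof (rule that)
    fix r assume "r < n"
    then show "e r < n \<and> ((e r, c) \<in> P \<or> (e r, c') \<in> P)"
      using eY[of r] less unfolding Y_def e_def by simp
  next
    fix r r' assume "r < n" "r' < n" "e r = e r'" "h r = h r'"
    then show "r = r'" by (rule same)
  next
    fix r r' assume r: "r < n" "r' < n" "e r = e r'" "h r' < h r" and r': "(r', c) \<notin> P" "(r', c') \<notin> P"
    define m where "m = h r - h r'"
    have "h r' \<noteq> 0" using eY[OF r(2)] r' unfolding Y_def e_def by (cases "h r'") auto
    then have m: "0 < m" "m < h r" using r(4) unfolding m_def by auto
    have hm: "h ((?p ^^ m) r) = h r'" using h_shift[OF r(1), of m] m(2) r(4) unfolding m_def by simp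
    have em: "e ((?p ^^ m) r) = e r'" using e_shift[OF r(1), of m] m(2) r(3) by simp
    have "(?p ^^ m) r = r'" by (rule same[OF less[OF r(1)] r(2) em hm])
    moreover have "column_path A P c c' (\<lambda>i. (?p ^^ i) r) m"
      using before m by (intro path r) auto
    ultimately show "\<exists>q m. column_path A P c c' q m \<and> 0 < m \<and> q 0 = r \<and> q m = r' \<and>
        (\<forall>i\<le>m. q i < n \<and> e (q i) = e r)"
      using m less[OF r(1)] e_shift[OF r(1)]
      by (intro exI[of _ "\<lambda>i. (?p ^^ i) r"] exI[of _ m]) auto
  qed
qed

section \<open>Counting linked row pairs\<close>

text \<open>Consider a pair \<open>(s, t)\<close> for which \<open>t\<close> is not the earliest partner of \<open>s\<close> on the path of \<open>t\<close>, nor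
  \<open>s\<close> the earliest partner of \<open>t\<close> on the path of \<open>s\<close>. Replacing one of the two members by an earlier
  partner gives two crossing pairs. So each pair is determined by one member and the path of the other.\<close>

lemma card_noncrossing_le:
  fixes E :: "(nat \<times> nat) set" and e h :: "nat \<Rightarrow> nat"
  assumes E: "E \<subseteq> {..<n} \<times> {..<n}" and Y: "finite Y" "\<And>r. r < n \<Longrightarrow> e r \<in> Y"
    and same: "\<And>r r'. r < n \<Longrightarrow> r' < n \<Longrightarrow> e r = e r' \<Longrightarrow> h r = h r' \<Longrightarrow> r = r'"
    and crossing: "\<And>s t s0 t0. (s, t0) \<in> E \<Longrightarrow> (s0, t) \<in> E \<Longrightarrow> e s0 = e s \<Longrightarrow> e t0 = e t \<Longrightarrow>
       h s < h s0 \<Longrightarrow> h t < h t0 \<Longrightarrow> False"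
  shows "card E \<le> 2 * n * card Y"
proof -
  define E1 where "E1 = {(s, t) \<in> E. \<forall>t0. (s, t0) \<in> E \<and> e t0 = e t \<longrightarrow> h t0 \<le> h t}"
  define E2 where "E2 = {(s, t) \<in> E. \<forall>s0. (s0, t) \<in> E \<and> e s0 = e s \<longrightarrow> h s0 \<le> h s}"
  have E1: "(s, t) \<in> E" "\<And>t0. (s, t0) \<in> E \<Longrightarrow> e t0 = e t \<Longrightarrow> h t0 \<le> h t" if "(s, t) \<in> E1" for s t
    using that unfolding E1_def by simp_all
  have E2: "(s, t) \<in> E" "\<And>s0. (s0, t) \<in> E \<Longrightarrow> e s0 = e s \<Longrightarrow> h s0 \<le> h s" if "(s, t) \<in> E2" for s t
    using that unfolding E2_def by simp_all
  have fin: "finite ({..<n} \<times> Y)" "finite (Y \<times> {..<n})" using Y(1) by auto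
  have "card E1 \<le> card ({..<n} \<times> Y)"
  proof (rule card_inj_on_le[OF _ _ fin(1)])
    show "inj_on (\<lambda>(s, t). (s, e t)) E1"
    proof (intro inj_onI, clarsimp)
      fix s t t' assume st: "(s, t) \<in> E1" "(s, t') \<in> E1" "e t = e t'"
      have "h t = h t'"
        using E1(2)[OF st(1) E1(1)[OF st(2)]] E1(2)[OF st(2) E1(1)[OF st(1)]] st(3) by simp
      moreover have "t < n" "t' < n" using E1(1)[OF st(1)] E1(1)[OF st(2)] E by auto
      ultimately show "t = t'" using same st(3) by blast
    qed
    show "(\<lambda>(s, t). (s, e t)) ` E1 \<subseteq> {..<n} \<times> Y" using E Y(2) unfolding E1_def by auto
  qed
  moreover have "card E2 \<le> card (Y \<times> {..<n})"
  proof (rule card_inj_on_le[OF _ _ fin(2)])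
    show "inj_on (\<lambda>(s, t). (e s, t)) E2"
    proof (intro inj_onI, clarsimp)
      fix s s' t assume st: "(s, t) \<in> E2" "(s', t) \<in> E2" "e s = e s'"
      have "h s = h s'"
        using E2(2)[OF st(1) E2(1)[OF st(2)]] E2(2)[OF st(2) E2(1)[OF st(1)]] st(3) by simp
      moreover have "s < n" "s' < n" using E2(1)[OF st(1)] E2(1)[OF st(2)] E by auto
      ultimately show "s = s'" using same st(3) by blast
    qed
    show "(\<lambda>(s, t). (e s, t)) ` E2 \<subseteq> Y \<times> {..<n}" using E Y(2) unfolding E2_def by auto
  qed
  moreover have "E = E1 \<union> E2"
  proof
    show "E1 \<union> E2 \<subseteq> E" unfolding E1_def E2_def by auto
    show "E \<subseteq> E1 \<union> E2"
    proof (rule subrelI)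
      fix s t assume st: "(s, t) \<in> E"
      show "(s, t) \<in> E1 \<union> E2"
      proof (rule ccontr)
        assume "(s, t) \<notin> E1 \<union> E2"
        then obtain t0 s0 where "(s, t0) \<in> E" "e t0 = e t" "h t < h t0" "(s0, t) \<in> E" "e s0 = e s" "h s < h s0"
          using st unfolding E1_def E2_def mem_Collect_eq case_prod_conv Un_iff not_le[symmetric] by blast
        then show False using crossing by blast
      qed
    qed
  qed
  then have "card E \<le> card E1 + card E2" using card_Un_le[of E1 E2] by simp
  moreover have "2 * n * card Y = n * card Y + card Y * n" by simp
  ultimately show ?thesis unfolding card_cartesian_product card_lessThan by linarith
qed

text \<open>Pairs are ordered so that \<open>c\<close> precedes \<open>c'\<close> in the column permutation of \<open>s\<close>, \<open>t\<close>. Chains of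
  length 1 are excluded because the reverse exchange is trivial for them.\<close>

definition linked :: "nat \<Rightarrow> (nat \<Rightarrow> nat \<Rightarrow> nat) \<Rightarrow> (nat \<times> nat) set \<Rightarrow> nat \<Rightarrow> nat \<Rightarrow> (nat \<times> nat) set" where
  "linked n A P c c' = {(s, t). s < n \<and> t < n \<and> s \<noteq> t \<and>
     (\<exists>q k. chain A P s t q k \<and> 1 < k \<and> q 0 = c \<and> q k = c' \<and> (\<forall>i\<le>k. q i < n))}"

lemma linkedE:
  assumes "(s, t) \<in> linked n A P c c'"
  obtains q k where "s < n" "t < n" "s \<noteq> t" "chain A P s t q k" "1 < k" "q 0 = c" "q k = c'"
    "\<And>i. i \<le> k \<Longrightarrow> q i < n"
  using assms unfolding linked_def by blast

lemma linked_free: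
  assumes "(s, t) \<in> linked n A P c c'"
  shows "s < n" "t < n" "(s, c) \<notin> P" "(s, c') \<notin> P" "(t, c) \<notin> P" "(t, c') \<notin> P" "s \<noteq> t" "c \<noteq> c'"
proof -
  obtain q k where st: "s < n" "t < n" "s \<noteq> t" and q: "chain A P s t q k" "1 < k" "q 0 = c" "q k = c'"
    by (rule linkedE[OF assms]) (rule that)
  have inj: "inj_on q {..k}" and free: "\<And>i. i \<le> k \<Longrightarrow> (s, q i) \<notin> P \<and> (t, q i) \<notin> P"
    using q(1) unfolding chain_def by simp_all
  show "s < n" "t < n" "s \<noteq> t" by (fact st)+
  show "(s, c) \<notin> P" "(s, c') \<notin> P" "(t, c) \<notin> P" "(t, c') \<notin> P"
    using free[of 0] free[of k] q(3,4) by simp_all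
  show "c \<noteq> c'" using inj_onD[OF inj, of 0 k] q(2-4) by auto
qed

lemma card_linked_le:
  assumes rig: "rigid n A P" and cc: "c < n" "c' < n" "c \<noteq> c'"
  shows "card (linked n A P c c') \<le> 2 * n * card {r. r < n \<and> ((r, c) \<in> P \<or> (r, c') \<in> P)}"
proof -
  have A: "latin_array n A" by (rule rigid_latin_array[OF rig])
  let ?Y = "{r. r < n \<and> ((r, c) \<in> P \<or> (r, c') \<in> P)}"
  let ?E = "linked n A P c c'"
  obtain e h :: "nat \<Rightarrow> nat" where
    eY: "\<And>r. r < n \<Longrightarrow> e r < n \<and> ((e r, c) \<in> P \<or> (e r, c') \<in> P)" and
    same: "\<And>r r'. r < n \<Longrightarrow> r' < n \<Longrightarrow> e r = e r' \<Longrightarrow> h r = h r' \<Longrightarrow> r = r'" and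
    path: "\<And>r r'. r < n \<Longrightarrow> r' < n \<Longrightarrow> e r = e r' \<Longrightarrow> h r' < h r \<Longrightarrow> (r', c) \<notin> P \<Longrightarrow> (r', c') \<notin> P \<Longrightarrow>
       \<exists>q m. column_path A P c c' q m \<and> 0 < m \<and> q 0 = r \<and> q m = r' \<and> (\<forall>i\<le>m. q i < n \<and> e (q i) = e r)"
    by (rule column_paths_exist[OF rig cc]) (rule that)
  note E = linked_free[where A = A and P = P and n = n and c = c and c' = c']
  \<comment> \<open>A linked pair can be used as a shortcut in both directions.\<close>
  have forward: "\<exists>M r d. exchange n A P c c' {s, t} {s} {t} M \<and> r \<in> {s, t} \<and> d < n \<and> M r d \<noteq> A r d"
    if mem: "(s, t) \<in> ?E" for s t
  proof -
    obtain q k where st: "s < n" "t < n" "s \<noteq> t" and q: "chain A P s t q k" "1 < k" "q 0 = c" "q k = c'"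
      "\<And>i. i \<le> k \<Longrightarrow> q i < n" by (rule linkedE[OF mem]) (rule that)
    have "0 < k" using q(2) by simp
    from exchange_chain[OF A st this q(1,5)] show ?thesis unfolding q(3,4) using cc by blast
  qed
  have backward: "\<exists>M r d. exchange n A P c c' {t, s} {t} {s} M \<and> r \<in> {t, s} \<and> d < n \<and> M r d \<noteq> A r d"
    if mem: "(s, t) \<in> ?E" for s t
  proof -
    obtain q k where st: "s < n" "t < n" "s \<noteq> t" and q: "chain A P s t q k" "1 < k" "q 0 = c" "q k = c'"
      "\<And>i. i \<le> k \<Longrightarrow> q i < n" by (rule linkedE[OF mem]) (rule that)
    have "q 1 < n" using q(2,5) by simp
    with exchange_chain_reverse[OF A st q(2,1,5)] show ?thesis
      unfolding q(3,4) insert_commute[of s t] by blast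
  qed
  have apart: "e s \<noteq> e t" if st: "(s, t) \<in> ?E" for s t
  proof
    assume eq: "e s = e t"
    note E = E[OF st]
    have "h s \<noteq> h t" using same[OF E(1,2) eq] E(7) by blast
    then consider "h s < h t" | "h t < h s" by linarith
    then show False
    proof cases
      case 1
      obtain q m where q: "column_path A P c c' q m" "0 < m" "q 0 = t" "q m = s" "\<And>i. i \<le> m \<Longrightarrow> q i < n"
        using path[OF E(2,1) eq[symmetric] 1 E(3,4)] by blast
      obtain M r d where M: "exchange n A P c c' {s, t} {s} {t} M" "r \<in> {s, t}" "d < n" "M r d \<noteq> A r d"
        using forward[OF st] by blast
      show False by (rule rigid_no_chain_over_path[OF rig cc M q])
    next
      case 2
      obtain q m where q: "column_path A P c c' q m" "0 < m" "q 0 = s" "q m = t" "\<And>i. i \<le> m \<Longrightarrow> q i < n"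
        using path[OF E(1,2) eq 2 E(5,6)] by blast
      obtain M r d where M: "exchange n A P c c' {t, s} {t} {s} M" "r \<in> {t, s}" "d < n" "M r d \<noteq> A r d"
        using backward[OF st] by blast
      show False by (rule rigid_no_chain_over_path[OF rig cc M q])
    qed
  qed
  show ?thesis
  proof (rule card_noncrossing_le[where e = e and h = h])
    show "?E \<subseteq> {..<n} \<times> {..<n}" unfolding linked_def by auto
    show "e r \<in> ?Y" if "r < n" for r using eY[OF that] by simp
    show "r = r'" if "r < n" "r' < n" "e r = e r'" "h r = h r'" for r r' using same that by blast
  next
    fix s t s0 t0
    assume st: "(s, t0) \<in> ?E" "(s0, t) \<in> ?E" and e: "e s0 = e s" "e t0 = e t"
      and h: "h s < h s0" "h t < h t0"
    note E1 = E[OF st(1)] and E2 = E[OF st(2)]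
    obtain q m where q: "column_path A P c c' q m" "0 < m" "q 0 = t0" "q m = t"
        "\<And>i. i \<le> m \<Longrightarrow> q i < n" "\<And>i. i \<le> m \<Longrightarrow> e (q i) = e t0"
      using path[OF E1(2) E2(2) e(2) h(2) E2(5,6)] by blast
    obtain q' m' where q': "column_path A P c c' q' m'" "0 < m'" "q' 0 = s0" "q' m' = s"
        "\<And>i. i \<le> m' \<Longrightarrow> q' i < n" "\<And>i. i \<le> m' \<Longrightarrow> e (q' i) = e s0"
      using path[OF E2(1) E1(1) e(1) h(1) E1(3,4)] by blast
    have disj: "q ` {..m} \<inter> q' ` {..m'} = {}"
      using q(6) q'(6) apart[OF st(1)] e by (auto simp: disjoint_iff) metis
    obtain M r d where M: "exchange n A P c c' {s, t0} {s} {t0} M" "r \<in> {s, t0}" "d < n" "M r d \<noteq> A r d"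
      using forward[OF st(1)] by blast
    obtain M' where M': "exchange n A P c c' {t, s0} {t} {s0} M'" using backward[OF st(2)] by blast
    show False
      using rigid_no_crossing_chains[OF rig cc M(1) M' M(2-4) q(1-5) q'(1-5) disj] by blast
  qed simp
qed

lemma mem_linked:
  assumes rig: "rigid n A P" and st: "s < n" "t < n" "s \<noteq> t" and d: "d < n" and k: "1 < k"
    and free: "\<And>i. i \<le> k \<Longrightarrow> (s, (link n A s t ^^ i) d) \<notin> P \<and> (t, (link n A s t ^^ i) d) \<notin> P"
  shows "(s, t) \<in> linked n A P d ((link n A s t ^^ k) d)"
proof -
  let ?q = "\<lambda>i. (link n A s t ^^ i) d"
  have "chain A P s t ?q k" by (rule chain_link[OF rig st d free])
  moreover have "?q i < n" for i by (rule link_funpow_less[OF rigid_latin_array[OF rig] st(1,2) d])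
  ultimately show ?thesis
    unfolding linked_def mem_Collect_eq case_prod_conv using st k
    by (intro conjI exI[of _ ?q] exI[of _ k]) simp_all
qed

text \<open>Markov's inequality for the number of prescribed cells in a row.\<close>

lemma card_heavy_le:
  fixes l :: real and n :: nat
  assumes "P \<subseteq> {..<n} \<times> {..<n}"
  shows "l * real (card {r. r < n \<and> l < real (card (P `` {r}))}) \<le> real (card P)"
proof -
  let ?H = "{r. r < n \<and> l < real (card (P `` {r}))}"
  have "P = Sigma {..<n} (\<lambda>r. P `` {r})" using assms by auto
  moreover have "finite (P `` {r})" for r by (rule finite_subset[of _ "{..<n}"]) (use assms in auto)
  ultimately have "card P = (\<Sum>r<n. card (P `` {r}))" by (metis card_SigmaI finite_lessThan)
  then have "real (card P) = (\<Sum>r<n. real (card (P `` {r})))" by simp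
  also have "\<dots> \<ge> (\<Sum>r\<in>?H. real (card (P `` {r})))" by (rule sum_mono2) auto
  moreover have "(\<Sum>r\<in>?H. real (card (P `` {r}))) \<ge> (\<Sum>r\<in>?H. l)" by (rule sum_mono) auto
  ultimately show ?thesis by (simp add: mult.commute)
qed

text \<open>Chains that join two lightly prescribed columns \<open>c\<close>, \<open>c'\<close> and belong to two lightly prescribed
  rows are counted twice. With \<open>w = \<surd>n\<close>, a row or column is light if it has at most \<open>w / 50\<close> cells
  of \<open>P\<close>, which excludes at most a quarter of them. Counted by rows, the first column and the length
  \<open>k\<close>, where \<open>k\<close> takes at least \<open>w\<close> values, there are at least \<open>n\<^sup>2 / 2 \<cdot> w \<cdot> n / 4\<close> chains; counted by
  the two end columns there are at most \<open>n\<^sup>2 \<cdot> 2 n \<cdot> w / 25\<close>, and \<open>1 / 8 > 2 / 25\<close>.\<close>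

lemma rigid_card_ge:
  assumes rig: "rigid n A P" and n: "12 \<le> n"
  shows "real n * sqrt (real n) / 200 \<le> real (card P)"
proof (rule ccontr)
  define w where "w = sqrt (real n)"
  assume "\<not> ?thesis"
  then have small: "real (card P) < real n * w / 200" unfolding w_def by simp
  have ww: "w * w = real n" unfolding w_def by simp
  have w1: "1 \<le> w" unfolding w_def using n by simp
  have P: "P \<subseteq> {..<n} \<times> {..<n}" using rig unfolding rigid_def by (elim conjE)
  have A: "latin_array n A" by (rule rigid_latin_array[OF rig])
  define R where "R = {r. r < n \<and> real (card (P `` {r})) \<le> w / 50}"
  define C where "C = {d. d < n \<and> real (card (P\<inverse> `` {d})) \<le> w / 50}"
  have heavy: "real (card {r. r < n \<and> w / 50 < real (card (Q `` {r}))}) \<le> real n / 4"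
    if "Q \<subseteq> {..<n} \<times> {..<n}" "card Q = card P" for Q
  proof -
    have "w / 50 * real (card {r. r < n \<and> w / 50 < real (card (Q `` {r}))}) \<le> real (card P)"
      using card_heavy_le[OF that(1), of "w / 50"] unfolding that(2) .
    also have "\<dots> \<le> w / 50 * (real n / 4)" using small by (simp add: mult.commute)
    finally show ?thesis using w1 by simp
  qed
  have card_compl: "real (card {d. d < n \<and> d \<notin> C}) \<le> real n / 4"
  proof -
    have "{d. d < n \<and> d \<notin> C} = {r. r < n \<and> w / 50 < real (card (P\<inverse> `` {r}))}"
      unfolding C_def by auto
    moreover have "card (P\<inverse>) = card P" by (rule card_inverse)
    ultimately show ?thesis using heavy[of "P\<inverse>"] P by auto
  qed
  have cardR: "3 / 4 * real n \<le> real (card R)"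
  proof -
    have "{..<n} = R \<union> {r. r < n \<and> w / 50 < real (card (P `` {r}))}" unfolding R_def by auto
    then have "n \<le> card R + card {r. r < n \<and> w / 50 < real (card (P `` {r}))}"
      by (metis card_Un_le card_lessThan)
    then show ?thesis using heavy[OF P] by linarith
  qed
  have finR: "finite R" and finC: "finite C" unfolding R_def C_def by auto
  define J where "J = {(s, t). s \<in> R \<and> t \<in> R \<and> s \<noteq> t}"
  have finJ: "finite J" by (rule finite_subset[of _ "R \<times> R"]) (use finR J_def in auto)
  have cardJ: "real n * real n / 2 \<le> real (card J)"
  proof -
    have "R \<times> R \<subseteq> J \<union> (\<lambda>r. (r, r)) ` R" unfolding J_def by auto
    then have "card (R \<times> R) \<le> card J + card ((\<lambda>r. (r, r)) ` R)"
      using finJ finR by (meson card_Un_le card_mono finite_UnI finite_imageI order_trans)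
    also have "card ((\<lambda>r. (r, r)) ` R) \<le> card R" by (rule card_image_le[OF finR])
    finally have "real (card R * card R) \<le> real (card J + card R)"
      unfolding card_cartesian_product of_nat_le_iff by simp
    then have J: "real (card R) * (real (card R) - 1) \<le> real (card J)" by (simp add: algebra_simps)
    have "(3 / 4 * real n) * (3 / 4 * real n - 1) \<le> real (card R) * (real (card R) - 1)"
      using cardR n by (intro mult_mono) auto
    moreover have "0 \<le> real n * (real n - 12)" using n by simp
    ultimately show ?thesis using J by (simp add: algebra_simps)
  qed
  \<comment> \<open>Lengths from 2 to \<open>K\<close> are considered: at least \<open>w\<close> of them, but each so short that cells of \<open>P\<close>
    spoil at most a quarter of the possible starting columns.\<close>
  define K where "K = Suc (nat \<lceil>w\<rceil>)"
  have K: "w \<le> real K - 1" "real K \<le> w + 2" unfolding K_def using w1 by linarith+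
  define G where "G s t k = {c \<in> C. (link n A s t ^^ k) c \<in> C \<and>
      (\<forall>i\<le>k. (s, (link n A s t ^^ i) c) \<notin> P \<and> (t, (link n A s t ^^ i) c) \<notin> P)}" for s t k
  have finG: "finite (G s t k)" for s t k unfolding G_def using finC by simp
  have cardG: "real n / 4 \<le> real (card (G s t k))" if st: "(s, t) \<in> J" and k: "k \<le> K" for s t k
  proof -
    have st': "s < n" "t < n" and light: "real (card (P `` {s})) \<le> w / 50" "real (card (P `` {t})) \<le> w / 50"
      using st unfolding J_def R_def by auto
    let ?p = "link n A s t"
    have preimage: "card {c. c < n \<and> (?p ^^ i) c \<in> Z} \<le> card Z" if "finite Z" for i Z
      by (rule card_inj_on_le[OF inj_on_subset[OF inj_on_link_funpow[OF A st', of i]] _ that]) auto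
    define X where "X = P `` {s} \<union> P `` {t}"
    have finP: "finite P" by (rule finite_subset[OF P]) simp
    have finX: "finite X" unfolding X_def using finP by (simp add: finite_Image)
    have "real (card X) \<le> real (card (P `` {s})) + real (card (P `` {t}))"
      unfolding X_def by (metis card_Un_le of_nat_add of_nat_le_iff)
    then have cardX: "real (card X) \<le> w / 25" using light by simp
    let ?H = "{d. d < n \<and> d \<notin> C}"
    let ?U = "\<Union>i\<le>k. {c. c < n \<and> (?p ^^ i) c \<in> X}"
    \<comment> \<open>A starting column is bad only if the chain meets \<open>P\<close> or one of its two ends is a heavy column.\<close>
    have cover: "{..<n} \<subseteq> G s t k \<union> ?U \<union> (?H \<union> {c. c < n \<and> (?p ^^ k) c \<in> ?H})"
      unfolding G_def X_def using link_funpow_less[OF A st'] by auto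
    have fin: "finite (G s t k \<union> ?U \<union> (?H \<union> {c. c < n \<and> (?p ^^ k) c \<in> ?H}))"
      using finG by simp
    have "n \<le> card (G s t k \<union> ?U \<union> (?H \<union> {c. c < n \<and> (?p ^^ k) c \<in> ?H}))"
      using card_mono[OF fin cover] unfolding card_lessThan .
    also have "\<dots> \<le> card (G s t k) + card ?U + (card ?H + card {c. c < n \<and> (?p ^^ k) c \<in> ?H})"
      by (intro order_trans[OF card_Un_le] add_mono card_Un_le order_refl)
    also have "\<dots> \<le> card (G s t k) + (\<Sum>i\<le>k. card X) + (card ?H + card ?H)"
      using preimage[of ?H k]
      by (intro add_mono order_refl order_trans[OF card_UN_le] sum_mono preimage finX) simp_all
    finally have "n \<le> card (G s t k) + Suc k * card X + 2 * card ?H" by simp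
    then have "real n \<le> real (card (G s t k) + Suc k * card X + 2 * card ?H)" by (simp only: of_nat_le_iff)
    then have "real n \<le> real (card (G s t k)) + real (Suc k) * real (card X) + 2 * real (card ?H)"
      by (simp only: of_nat_add of_nat_mult of_nat_numeral)
    moreover have "real (Suc k) * real (card X) \<le> (w + 3) * (w / 25)"
      using k K(2) cardX w1 by (intro mult_mono) auto
    moreover have "(w + 3) * (w / 25) \<le> real n / 4"
    proof -
      have "3 * w \<le> 3 * (w * w)" using w1 by simp
      then show ?thesis using ww by (simp add: algebra_simps)
    qed
    ultimately show ?thesis using card_compl by linarith
  qed
  define \<Omega> where "\<Omega> = Sigma J (\<lambda>(s, t). Sigma {2..K} (G s t))"
  have fin\<Omega>: "finite (Sigma {2..K} (G s t))" for s t using finG by (intro finite_SigmaI) auto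
  have lower: "real n * real n / 2 * (w * (real n / 4)) \<le> real (card \<Omega>)"
  proof -
    have fibre: "w * (real n / 4) \<le> real (card (Sigma {2..K} (G s t)))" if "(s, t) \<in> J" for s t
    proof -
      have "w * (real n / 4) \<le> (real K - 1) * (real n / 4)" using K(1) by (intro mult_right_mono) auto
      also have "\<dots> = (\<Sum>k\<in>{2..K}. real n / 4)" using K(1) w1 by (simp add: of_nat_diff)
      also have "\<dots> \<le> (\<Sum>k\<in>{2..K}. real (card (G s t k)))" using cardG[OF that] by (intro sum_mono) auto
      also have "\<dots> = real (card (Sigma {2..K} (G s t)))" using finG by (simp add: card_SigmaI)
      finally show ?thesis .
    qed
    have "real n * real n / 2 * (w * (real n / 4)) \<le> real (card J) * (w * (real n / 4))"
      using cardJ w1 by (intro mult_right_mono) auto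
    also have "\<dots> = (\<Sum>x\<in>J. w * (real n / 4))" by simp
    also have "\<dots> \<le> (\<Sum>x\<in>J. real (card (case x of (s, t) \<Rightarrow> Sigma {2..K} (G s t))))"
      using fibre by (intro sum_mono) auto
    also have "\<dots> = real (card \<Omega>)"
      unfolding \<Omega>_def using finJ fin\<Omega> by (subst card_SigmaI) auto
    finally show ?thesis .
  qed
  define W where "W = Sigma (C \<times> C) (\<lambda>(c, c'). linked n A P c c')"
  have finL: "finite (linked n A P c c')" for c c'
    by (rule finite_subset[of _ "{..<n} \<times> {..<n}"]) (auto simp: linked_def)
  have upper: "real (card W) \<le> real n * real n * (2 * real n * (w / 25))"
  proof -
    have fibre: "real (card (linked n A P c c')) \<le> 2 * real n * (w / 25)" if "c \<in> C" "c' \<in> C" for c c'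
    proof (cases "c = c'")
      case True
      then have "linked n A P c c' = {}" using linked_free(8)[where A = A and P = P] by fast
      then show ?thesis using w1 by simp
    next
      case False
      have "{r. r < n \<and> ((r, c) \<in> P \<or> (r, c') \<in> P)} = P\<inverse> `` {c} \<union> P\<inverse> `` {c'}" using P by auto
      then have "real (card {r. r < n \<and> ((r, c) \<in> P \<or> (r, c') \<in> P)}) \<le>
          real (card (P\<inverse> `` {c})) + real (card (P\<inverse> `` {c'}))"
        by (metis card_Un_le of_nat_add of_nat_le_iff)
      also have "\<dots> \<le> w / 25" using that unfolding C_def by simp
      finally have Y: "real (card {r. r < n \<and> ((r, c) \<in> P \<or> (r, c') \<in> P)}) \<le> w / 25" .
      have "card (linked n A P c c') \<le> 2 * n * card {r. r < n \<and> ((r, c) \<in> P \<or> (r, c') \<in> P)}"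
        using that False by (intro card_linked_le[OF rig]) (auto simp: C_def)
      then have "real (card (linked n A P c c')) \<le>
          real (2 * n * card {r. r < n \<and> ((r, c) \<in> P \<or> (r, c') \<in> P)})" by (simp only: of_nat_le_iff)
      also have "\<dots> = 2 * real n * real (card {r. r < n \<and> ((r, c) \<in> P \<or> (r, c') \<in> P)})" by simp
      also have "\<dots> \<le> 2 * real n * (w / 25)" using Y by (intro mult_left_mono) auto
      finally show ?thesis .
    qed
    have "real (card W) = (\<Sum>x\<in>C \<times> C. real (card (case x of (c, c') \<Rightarrow> linked n A P c c')))"
      unfolding W_def using finC finL by (subst card_SigmaI) auto
    also have "\<dots> \<le> (\<Sum>x\<in>C \<times> C. 2 * real n * (w / 25))" using fibre by (intro sum_mono) auto
    also have "\<dots> = real (card C * card C) * (2 * real n * (w / 25))" by (simp add: card_cartesian_product)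
    also have "\<dots> \<le> real (n * n) * (2 * real n * (w / 25))"
    proof -
      have "card C \<le> card {..<n}" by (intro card_mono) (auto simp: C_def)
      then have "card C * card C \<le> n * n" by (intro mult_mono) auto
      then show ?thesis using w1 by (intro mult_right_mono) (simp_all only: of_nat_le_iff, simp)
    qed
    finally show ?thesis by simp
  qed
  \<comment> \<open>The length is determined by the rows and the end columns, as the columns of a chain are distinct.\<close>
  have "card \<Omega> \<le> card W"
  proof (rule card_inj_on_le)
    let ?f = "\<lambda>((s, t), (k, c)). ((c, (link n A s t ^^ k) c), (s :: nat, t :: nat))"
    have mem: "s < n" "t < n" "s \<noteq> t" "1 < k" "c \<in> C" "c < n" "(link n A s t ^^ k) c \<in> C"
        "\<And>i. i \<le> k \<Longrightarrow> (s, (link n A s t ^^ i) c) \<notin> P \<and> (t, (link n A s t ^^ i) c) \<notin> P"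
      if "((s, t), (k, c)) \<in> \<Omega>" for s t k c
      using that unfolding \<Omega>_def J_def R_def G_def C_def by auto
    show "?f ` \<Omega> \<subseteq> W"
      unfolding W_def using mem mem_linked[OF rig] by auto
    have le: "k \<le> k'" if "((s, t), (k, c)) \<in> \<Omega>" "((s, t), (k', c)) \<in> \<Omega>"
      "(link n A s t ^^ k) c = (link n A s t ^^ k') c" for s t k k' c
    proof -
      have "inj_on (\<lambda>i. (link n A s t ^^ i) c) {..k}"
        using chain_link[OF rig mem(1-3,6,8)[OF that(1)]] unfolding chain_def by blast
      then show ?thesis using that(3) by (metis atMost_iff inj_onD nat_le_linear order_refl)
    qed
    show "inj_on ?f \<Omega>"
    proof (rule inj_onI)
      fix x y assume xy: "x \<in> \<Omega>" "y \<in> \<Omega>" "?f x = ?f y"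
      obtain s t k c where x: "x = ((s, t), (k, c))" by (metis surj_pair)
      obtain s' t' k' c' where y: "y = ((s', t'), (k', c'))" by (metis surj_pair)
      have eq: "s' = s" "t' = t" "c' = c" and "(link n A s t ^^ k) c = (link n A s' t' ^^ k') c'"
        using xy(3) unfolding x y by auto
      then have "(link n A s t ^^ k) c = (link n A s t ^^ k') c" by simp
      then have "k \<le> k'" "k' \<le> k"
        using le xy(1,2) unfolding x y eq by metis+
      then show "x = y" unfolding x y eq by simp
    qed
    show "finite W" unfolding W_def using finC finL by (intro finite_SigmaI) auto
  qed
  then have "real (card \<Omega>) \<le> real (card W)" by simp
  then have "real n * real n / 2 * (w * (real n / 4)) \<le> real n * real n * (2 * real n * (w / 25))"
    using lower upper by linarith
  moreover have "0 < real n * real n * real n * w" using n w1 by simp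
  ultimately show False by (simp add: algebra_simps)
qed

theorem theorem1p4:
  shows "\<exists>c::real. c > 0 \<and>
    (\<exists>n0::nat. \<forall>n\<ge>n0. \<forall>L D. latin_square n L \<and> defining_set n L D \<longrightarrow>
       real (card D) \<ge> c * real n powr (3/2))"
proof (intro exI[of _ "1 / 200"] conjI exI[of _ 12] allI impI)
  fix n L D assume n: "(12::nat) \<le> n" and LD: "latin_square n L \<and> defining_set n L D"
  obtain A where A: "latin_array n A" and L: "L = array_triples n A"
    using LD unfolding latin_square_def by blast
  have D: "D \<subseteq> array_triples n A"
    and unique: "\<And>B. latin_array n B \<Longrightarrow> D \<subseteq> array_triples n B \<Longrightarrow> array_triples n B = array_triples n A"
    using LD L unfolding defining_set_def latin_square_def by blast+
  define P where "P = {(i, j). (i, j, A i j) \<in> D}"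
  have P: "P \<subseteq> {..<n} \<times> {..<n}" using D unfolding P_def array_triples_def by auto
  have DP: "D = (\<lambda>(i, j). (i, j, A i j)) ` P"
    using D unfolding P_def array_triples_def by (force simp: image_iff)
  have "rigid n A P"
    unfolding rigid_def
  proof (intro conjI allI impI A P)
    fix B i j assume B: "latin_array n B \<and> (\<forall>(i, j)\<in>P. B i j = A i j)" and ij: "i < n" "j < n"
    have "D \<subseteq> array_triples n B"
      unfolding DP array_triples_def using B P by force
    then have "array_triples n B = array_triples n A" using unique B by blast
    moreover have "(i, j, B i j) \<in> array_triples n B" using ij unfolding array_triples_def by blast
    ultimately show "B i j = A i j" unfolding array_triples_def by auto
  qed
  then have "real n * sqrt (real n) / 200 \<le> real (card P)" by (rule rigid_card_ge[OF _ n])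
  moreover have "card D = card P" unfolding DP by (rule card_image) (auto simp: inj_on_def)
  moreover have "real n powr (3/2) = real n * sqrt (real n)"
  proof -
    have "real n powr (3/2) = real n powr (1 + 1/2)" by simp
    also have "\<dots> = real n * sqrt (real n)" using n by (simp only: powr_add powr_half_sqrt) simp
    finally show ?thesis .
  qed
  ultimately show "real (card D) \<ge> 1 / 200 * real n powr (3/2)" by simp
qed simp

end
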